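(* Let $n,m\ge1$ be integers, $T>0$, $0<\beta<1$, $r\in\mathbb R$, and let $c,f,z,u_{\min}$ (functions of $(x,t)$) and $g$ (function of $x$) be given real-valued functions. With $\mathbf H,\mathbf c,c_0,\mathbf A,\mathbf b,\mathbf B,\mathbf h$ defined from these data as in the context, the quadratic optimization problem $$\min_{\mathbf v\in\mathbb R^{n(2m+1)}}\ J_{n,m}(\mathbf v)=\tfrac12\mathbf v^{T}\mathbf H\mathbf v+\mathbf c^{T}\mathbf v+c_0\quad\text{subject to}\quad \mathbf A\mathbf v=\mathbf b,\quad \mathbf B\mathbf v\le\mathbf h$$ is a convex optimization problem.
   Context: A minimization problem is called convex if its objective function is convex, its equality constraints are affine, and its inequality constraints are of the form $\phi(\mathbf v)\le 0$ with $\phi$ convex (e.g. affine). Vector inequalities are componentwise; $\otimes$ is the Kronecker product; $\mathbf{vec}$ stacks the columns of a matrix; $\mathbf I_p$ is the $p\times p$ identity and $\mathbf 0_{p\times q}$ the zero matrix. Space nodes and weights: let $P_k^{(a,b)}$ denote the Jacobi polynomials, orthogonal on $[-1,1]$ with weight $(1-\tau)^a(1+\tau)^b$. Let $\xi_1^{(1,1)},\dots,\xi_n^{(1,1)}$ be the zeros of $P_n^{(1,1)}$ and $\omega_1^{(1,1)},\dots,\omega_n^{(1,1)}$ the Gauss quadrature weights, i.e. $\int_{-1}^1(1-x)(1+x)p(x)\,dx=\sum_{i=1}^n\omega^{(1,1)}_i p(\xi_i^{(1,1)})$ for all polynomials $p$ of degree at most $2n-1$. Put $\hat\xi_i=\frac12(\xi_i^{(1,1)}+1)$.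 Time nodes and weights: let $\tau_1=-1<\tau_2<\dots<\tau_m<1$ be the $m$ Legendre--Gauss--Radau nodes (the zeros of $P_{m-1}^{(0,0)}+P_m^{(0,0)}$) and $\varpi_1^{(0,0)},\dots,\varpi_m^{(0,0)}$ the corresponding weights, i.e. $\int_{-1}^1p(t)\,dt=\sum_{i=1}^m\varpi_i^{(0,0)}p(\tau_i)$ for all polynomials $p$ of degree at most $2m-2$. Put $\hat\tau_j=\frac T2(\tau_j+1)$ for $j\le m$ and $\hat\tau_{m+1}=T$. Let $\bar\ell_1,\dots,\bar\ell_{m+1}$ be the Lagrange basis polynomials on $\hat\tau_1,\dots,\hat\tau_{m+1}$, and $\mathbf D=[\bar\ell_k'(\hat\tau_j)]_{j=1,\dots,m;\ k=1,\dots,m+1}\in\mathbb R^{m\times(m+1)}$. Fractional differentiation matrix: with $$\mathring\ell_j(x)=\frac{x(1-x)}{\hat\xi_j(1-\hat\xi_j)}\prod_{k\ne j}\frac{x-\hat\xi_k}{\hat\xi_j-\hat\xi_k},$$ let $\mathfrak D_{\pm}^{2-\beta}\in\mathbb R^{n\times n}$ have entries $r\,{}_0\mathcal D_x^{2-\beta}\mathring\ell_j(\hat\xi_i)+(1-r)\,{}_x\mathcal D_1^{2-\beta}\mathring\ell_j(\hat\xi_i)$, where, for $\alpha=2-\beta$, the left and right Riemann--Liouville derivatives are ${}_0\mathcal D_x^\alpha\phi(x)=\frac1{\Gamma(2-\alpha)}\frac{d^2}{dx^2}\int_0^x(x-s)^{1-\alpha}\phi(s)\,ds$ and ${}_x\mathcal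 D_1^\alpha\phi(x)=\frac1{\Gamma(2-\alpha)}\frac{d^2}{dx^2}\int_x^1(s-x)^{1-\alpha}\phi(s)\,ds$. Data: $\boldsymbol\omega=\frac12(\omega_1^{(1,1)},\dots,\omega_n^{(1,1)})^T$, $\boldsymbol\varpi=\frac T2(\varpi_1^{(0,0)},\dots,\varpi_m^{(0,0)})^T$, $\mathbf S=\mathrm{diag}(\boldsymbol\varpi\otimes\boldsymbol\omega)\in\mathbb R^{nm\times nm}$; the $n\times m$ matrices $\mathbf Z=\big[\tfrac{z(\hat\xi_i,\hat\tau_j)}{\hat\xi_i(1-\hat\xi_i)}\big]$, $\bar{\mathbf C}=[c(\hat\xi_i,\hat\tau_j)]$, $\mathbf F=[f(\hat\xi_i,\hat\tau_j)]$, $\mathbf U_{\min}=[u_{\min}(\hat\xi_i,\hat\tau_j)]$; $\mathbf g=(g(\hat\xi_1),\dots,g(\hat\xi_n))^T$; $\mathbf I_{\mathbf C}=\mathrm{diag}(\mathbf{vec}(\bar{\mathbf C}))$; $\bar{\mathbf I}_m\in\mathbb R^{(m+1)\times m}$ is $\mathbf I_{m+1}$ with its last column removed. Decision vector: $\mathbf v=(\mathbf y_1;\dots;\mathbf y_{m+1};\mathbf u_1;\dots;\mathbf u_m)\in\mathbb R^{n(2m+1)}$ with all $\mathbf y_j,\mathbf u_i\in\mathbb R^n$. The problem matrices are $$\mathbf H=\begin{bmatrix}\mathbf S&\mathbf 0_{nm\times n}&\mathbf 0_{nm\times nm}\\ \mathbf 0_{n\times nm}&\mathbf 0_{n\times n}&\mathbf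 0_{n\times nm}\\ \mathbf 0_{nm\times nm}&\mathbf 0_{nm\times n}&\mathbf S\end{bmatrix},\quad \mathbf c=-\begin{bmatrix}\mathbf S\,\mathbf{vec}(\mathbf Z)\\ \mathbf 0_{n\times1}\\ \mathbf 0_{nm\times1}\end{bmatrix},\quad c_0=\tfrac12\mathbf{vec}(\mathbf Z)^T\mathbf S\,\mathbf{vec}(\mathbf Z),$$ $$\mathbf A=\begin{bmatrix}[\,\mathbf I_n\ \ \mathbf 0_{n\times nm}\,]&\mathbf 0_{n\times nm}\\ (\mathbf D\otimes\mathbf I_n)-\mathbf I_{\mathbf C}(\bar{\mathbf I}_m^T\otimes\mathfrak D_\pm^{2-\beta})&-\mathbf I_{nm}\end{bmatrix},\quad \mathbf b=\begin{bmatrix}\mathbf g\\ \mathbf{vec}(\mathbf F)\end{bmatrix},$$ $$\mathbf B=-[\,\mathbf 0_{nm\times n(m+1)}\ \ \mathbf I_{nm}\,],\qquad \mathbf h=-\mathbf{vec}(\mathbf U_{\min}).$$ *)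

theory Defs
  imports "HOL-Analysis.Analysis" "Jordan_Normal_Form.Matrix"
begin

text \<open>Vectors and matrices are those of \<^theory>\<open>Jordan_Normal_Form.Matrix\<close>: dimensions are natural
  numbers and indices start at 0. Nodes and weights are indexed from 0 accordingly.\<close>

no_notation Finite_Cartesian_Product.vec_nth (infixl "$" 90)
no_notation inner (infix "\<bullet>" 70)

definition convex_fun :: "nat \<Rightarrow> (real vec \<Rightarrow> real) \<Rightarrow> bool" where
  "convex_fun N \<phi> \<longleftrightarrow>
     (\<forall>x \<in> carrier_vec N. \<forall>y \<in> carrier_vec N. \<forall>t. 0 \<le> t \<and> t \<le> 1 \<longrightarrow>
        \<phi> ((1 - t) \<cdot>\<^sub>v x + t \<cdot>\<^sub>v y) \<le> (1 - t) * \<phi> x + t * \<phi> y)"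

definition affine_fun :: "nat \<Rightarrow> (real vec \<Rightarrow> real) \<Rightarrow> bool" where
  "affine_fun N \<phi> \<longleftrightarrow>
     (\<exists>a \<in> carrier_vec N. \<exists>d. \<forall>x \<in> carrier_vec N. \<phi> x = a \<bullet> x + d)"

text \<open>Minimize \<open>objective\<close> over \<open>\<real>\<^sup>N\<close>, where \<open>N\<close> is \<open>num_vars\<close>, subject to \<open>\<psi> v = 0\<close> for \<open>\<psi>\<close> in
  \<open>eq_constraints\<close> and \<open>\<phi> v \<le> 0\<close> for \<open>\<phi>\<close> in \<open>ineq_constraints\<close>.\<close>

record min_problem =
  num_vars :: nat
  objective :: "real vec \<Rightarrow> real"
  eq_constraints :: "(real vec \<Rightarrow> real) set"
  ineq_constraints :: "(real vec \<Rightarrow> real) set"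

definition feasible_set :: "min_problem \<Rightarrow> real vec set" where
  "feasible_set P = {v \<in> carrier_vec (num_vars P).
     (\<forall>\<psi> \<in> eq_constraints P. \<psi> v = 0) \<and> (\<forall>\<phi> \<in> ineq_constraints P. \<phi> v \<le> 0)}"

definition convex_problem :: "min_problem \<Rightarrow> bool" where
  "convex_problem P \<longleftrightarrow>
     convex_fun (num_vars P) (objective P) \<and>
     (\<forall>\<psi> \<in> eq_constraints P. affine_fun (num_vars P) \<psi>) \<and>
     (\<forall>\<phi> \<in> ineq_constraints P. convex_fun (num_vars P) \<phi>)"

definition quadratic_problem ::
  "nat \<Rightarrow> real mat \<Rightarrow> real vec \<Rightarrow> real \<Rightarrow> real mat \<Rightarrow> real vec \<Rightarrow> real mat \<Rightarrow> real vec \<Rightarrow> min_problem"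
where
  "quadratic_problem N H c c0 A b B h = \<lparr>
     num_vars = N,
     objective = (\<lambda>v. 1 / 2 * (v \<bullet> (H *\<^sub>v v)) + c \<bullet> v + c0),
     eq_constraints = {\<lambda>v. (A *\<^sub>v v) $ k - b $ k | k. k < dim_row A},
     ineq_constraints = {\<lambda>v. (B *\<^sub>v v) $ k - h $ k | k. k < dim_row B} \<rparr>"

lemma feasible_set_quadratic_problem:
  assumes "dim_vec b = dim_row A" "dim_vec h = dim_row B"
  shows "feasible_set (quadratic_problem N H c c0 A b B h) =
    {v \<in> carrier_vec N. A *\<^sub>v v = b \<and> B *\<^sub>v v \<le> h}"
proof -
  have "(A *\<^sub>v v = b) = (\<forall>k < dim_row A. (A *\<^sub>v v) $ k - b $ k = 0)" for v
    using assms(1) by (auto simp: vec_eq_iff)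
  moreover have "(B *\<^sub>v v \<le> h) = (\<forall>k < dim_row B. (B *\<^sub>v v) $ k - h $ k \<le> 0)" for v
    using assms(2) by (auto simp: less_eq_vec_def)
  ultimately show ?thesis
    unfolding feasible_set_def quadratic_problem_def by auto
qed

definition kronecker :: "'a :: times mat \<Rightarrow> 'a mat \<Rightarrow> 'a mat" where
  "kronecker A B = mat (dim_row A * dim_row B) (dim_col A * dim_col B)
     (\<lambda>(i, j). A $$ (i div dim_row B, j div dim_col B) * B $$ (i mod dim_row B, j mod dim_col B))"

definition kronecker_vec :: "'a :: times vec \<Rightarrow> 'a vec \<Rightarrow> 'a vec" where
  "kronecker_vec u v = vec (dim_vec u * dim_vec v) (\<lambda>k. u $ (k div dim_vec v) * v $ (k mod dim_vec v))"

definition vec_of_mat :: "'a mat \<Rightarrow> 'a vec" where \<comment> \<open>stacks the columns\<close>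
  "vec_of_mat M = vec (dim_row M * dim_col M) (\<lambda>k. M $$ (k mod dim_row M, k div dim_row M))"

definition diag_of_vec :: "'a :: zero vec \<Rightarrow> 'a mat" where
  "diag_of_vec v = mat_diag (dim_vec v) (\<lambda>i. v $ i)"

definition append_cols :: "'a :: zero mat \<Rightarrow> 'a mat \<Rightarrow> 'a mat" where
  "append_cols A B = four_block_mat A B (0\<^sub>m 0 (dim_col A)) (0\<^sub>m 0 (dim_col B))"

text \<open>Szego, Orthogonal Polynomials, (4.3.2); the normalization is the usual one. The degree, the
  value at 1 and the orthogonality for natural \<open>a\<close>, \<open>b\<close>, which together determine the polynomial,
  are \<open>degree_jacobi_poly\<close>, \<open>poly_jacobi_poly_1\<close> and \<open>jacobi_poly_orthogonal\<close>.\<close>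

definition jacobi_poly :: "real \<Rightarrow> real \<Rightarrow> nat \<Rightarrow> real poly" where
  "jacobi_poly a b k = (\<Sum>s\<le>k. Polynomial.smult (((real k + a) gchoose (k - s)) * ((real k + b) gchoose s))
      ([:- 1 / 2, 1 / 2:] ^ s * [:1 / 2, 1 / 2:] ^ (k - s)))"

lemma higher_pderiv_linear_power:
  fixes u v :: real
  assumes "s \<le> N"
  shows "(pderiv ^^ s) ([:u, v:] ^ N) = Polynomial.smult (v ^ s * fact N / fact (N - s)) ([:u, v:] ^ (N - s))"
  using assms
proof (induction s)
  case (Suc s)
  define M where "M = N - Suc s"
  have M: "N - s = Suc M" using Suc.prems by (simp add: M_def)
  have d: "pderiv [:u, v:] = [:v:]" by (simp add: pderiv_pCons)
  have "(pderiv ^^ Suc s) ([:u, v:] ^ N) =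
      pderiv (Polynomial.smult (v ^ s * fact N / fact (Suc M)) ([:u, v:] ^ Suc M))"
    using Suc M by simp
  also have "\<dots> = Polynomial.smult (v ^ s * fact N / fact (Suc M)) (Polynomial.smult (of_nat (Suc M)) ([:u, v:] ^ M) * [:v:])"
    by (simp only: pderiv_smult pderiv_power_Suc d)
  also have "\<dots> = Polynomial.smult (v ^ s * fact N / fact (Suc M) * real (Suc M) * v) ([:u, v:] ^ M)"
    by (simp add: mult.assoc)
  also have "v ^ s * fact N / fact (Suc M) * real (Suc M) * v = v ^ Suc s * fact N / (fact M :: real)"
    by (simp add: field_simps del: of_nat_Suc)
  finally show ?case by (simp add: M_def)
qed simp

lemma higher_pderiv_mult:
  fixes p q :: "real poly"
  shows "(pderiv ^^ k) (p * q) =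
    (\<Sum>s\<le>k. Polynomial.smult (real (k choose s)) ((pderiv ^^ (k - s)) p * (pderiv ^^ s) q))"
proof (induction k)
  case (Suc k)
  define a where "a = (\<lambda>i j. (pderiv ^^ i) p * (pderiv ^^ j) q)"
  have pa: "pderiv (a i j) = a (Suc i) j + a i (Suc j)" for i j
    by (simp add: a_def pderiv_mult algebra_simps)
  have a': "a i j = (pderiv ^^ i) p * (pderiv ^^ j) q" for i j
    by (simp add: a_def)
  have ps: "pderiv (sum w I) = (\<Sum>i\<in>I. pderiv (w i))" for w :: "nat \<Rightarrow> real poly" and I
    by (induction I rule: infinite_finite_induct) (auto simp: pderiv_add)
  have "(pderiv ^^ Suc k) (p * q) = (\<Sum>s\<le>k. Polynomial.smult (real (k choose s)) (a (Suc (k - s)) s + a (k - s) (Suc s)))"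
    unfolding funpow.simps o_apply Suc ps pderiv_smult by (simp only: pa a'[symmetric])
  also have "\<dots> = (\<Sum>s\<le>k. Polynomial.smult (real (k choose s)) (a (Suc k - s) s)) +
     (\<Sum>s\<le>k. Polynomial.smult (real (k choose s)) (a (k - s) (Suc s)))"
    by (simp add: smult_add_right sum.distrib Suc_diff_le)
  also have "(\<Sum>s\<le>k. Polynomial.smult (real (k choose s)) (a (Suc k - s) s)) =
     (\<Sum>s\<le>Suc k. Polynomial.smult (real (k choose s)) (a (Suc k - s) s))"
    by simp
  also have "\<dots> = a (Suc k) 0 + (\<Sum>s\<le>k. Polynomial.smult (real (k choose Suc s)) (a (k - s) (Suc s)))"
    by (subst sum.atMost_Suc_shift) simp
  also have "\<dots> + (\<Sum>s\<le>k. Polynomial.smult (real (k choose s)) (a (k - s) (Suc s))) =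
     a (Suc k) 0 + (\<Sum>s\<le>k. Polynomial.smult (real (Suc k choose Suc s)) (a (k - s) (Suc s)))"
    by (simp add: sum.distrib smult_add_left algebra_simps)
  also have "\<dots> = (\<Sum>s\<le>Suc k. Polynomial.smult (real (Suc k choose s)) (a (Suc k - s) s))"
    by (subst sum.atMost_Suc_shift) simp
  finally show ?case by (simp add: a_def)
qed simp

lemma jacobi_poly_rodrigues:
  "(pderiv ^^ k) ([:1, -1:] ^ (a + k) * [:1, 1:] ^ (b + k)) =
    Polynomial.smult ((- 2) ^ k * fact k) ([:1, -1:] ^ a * [:1, 1:] ^ b * jacobi_poly (real a) (real b) k)"
proof -
  have h: "[:- 1 / 2, 1 / 2 :: real:] = Polynomial.smult (- 1 / 2) [:1, -1:]"
    "[:1 / 2, 1 / 2 :: real:] = Polynomial.smult (1 / 2) [:1, 1:]" by auto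
  have "Polynomial.smult (real (k choose s)) ((pderiv ^^ (k - s)) ([:1, -1:] ^ (a + k)) * (pderiv ^^ s) ([:1, 1:] ^ (b + k)))
     = Polynomial.smult ((- 2) ^ k * fact k) ([:1, -1:] ^ a * [:1, 1:] ^ b *
        Polynomial.smult (((real k + real a) gchoose (k - s)) * ((real k + real b) gchoose s))
      ([:- 1 / 2, 1 / 2:] ^ s * [:1 / 2, 1 / 2:] ^ (k - s)))" (is "?l = ?r") if s: "s \<le> k" for s
  proof -
    have g1: "((real k + real a) gchoose (k - s)) = fact (a + k) / (fact (k - s) * fact (a + s))"
      using s binomial_fact[of "k - s" "k + a", where ?'a = real]
      by (simp add: binomial_gbinomial add.commute)
    have g2: "((real k + real b) gchoose s) = fact (b + k) / (fact s * fact (b + k - s))"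
      using s binomial_fact[of s "k + b", where ?'a = real]
      by (simp add: binomial_gbinomial add.commute)
    have g3: "real (k choose s) = fact k / (fact s * fact (k - s))"
      using s by (simp add: binomial_fact)
    have e: "a + k - (k - s) = a + s" "b + k - s = b + (k - s)" using s by auto
    define X Y where "X = [:1, -1 :: real:] ^ (a + s)" and "Y = [:1, 1 :: real:] ^ (b + (k - s))"
    have l1: "(pderiv ^^ (k - s)) ([:1, -1:] ^ (a + k)) = Polynomial.smult ((-1) ^ (k - s) * fact (a + k) / fact (a + s)) X"
      using higher_pderiv_linear_power[of "k - s" "a + k" 1 "-1"] s unfolding e X_def by simp
    have l2: "(pderiv ^^ s) ([:1, 1:] ^ (b + k)) = Polynomial.smult (fact (b + k) / fact (b + (k - s))) Y"
      using higher_pderiv_linear_power[of s "b + k" 1 1] s unfolding e Y_def by simp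
    have l: "?l = Polynomial.smult (real (k choose s) * ((-1) ^ (k - s) * fact (a + k) / fact (a + s)) * (fact (b + k) / fact (b + (k - s))))
        (X * Y)"
      unfolding l1 l2 mult_smult_left mult_smult_right smult_smult by (simp only: mult_ac)
    have r: "?r = Polynomial.smult ((- 2) ^ k * fact k * (((real k + real a) gchoose (k - s)) * ((real k + real b) gchoose s)) * ((-1/2)^s * (1/2)^(k-s)))
        (X * Y)"
      unfolding h smult_power X_def Y_def mult_smult_left mult_smult_right smult_smult power_add
      by (simp only: mult_ac)
    have p: "(- 2) ^ k * ((-1/2)^s * (1/2)^(k-s)) = (-1 :: real) ^ (k - s)"
    proof -
      have "(-2 :: real) ^ k = (-2) ^ s * (-2) ^ (k - s)" using s by (simp flip: power_add)
      hence "(- 2) ^ k * ((-1/2)^s * (1/2)^(k-s)) = ((-2) * (-1/2)) ^ s * ((-2) * (1/2 :: real)) ^ (k - s)"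
        by (simp only: power_mult_distrib mult_ac)
      thus ?thesis by simp
    qed
    have "real (k choose s) * ((-1) ^ (k - s) * fact (a + k) / fact (a + s)) * (fact (b + k) / fact (b + (k - s)))
       = ((- 2) ^ k * ((-1/2)^s * (1/2)^(k-s))) * fact k * (((real k + real a) gchoose (k - s)) * ((real k + real b) gchoose s))"
      unfolding p g1 g2 g3 e by (simp add: mult_ac)
    thus ?thesis unfolding l r by (simp only: mult_ac)
  qed
  moreover have "Polynomial.smult w (sum p I) = (\<Sum>i\<in>I. Polynomial.smult w (p i))"
    for w :: real and p :: "nat \<Rightarrow> real poly" and I
    by (induction I rule: infinite_finite_induct) (auto simp: smult_add_right)
  ultimately show ?thesis
    unfolding higher_pderiv_mult jacobi_poly_def sum_distrib_left by (simp cong: sum.cong_simp del: smult_smult mult_smult_left mult_smult_right)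
qed

lemma jacobi_poly_orthogonal:
  assumes "degree q < k"
  shows "((\<lambda>x. (1 - x) ^ a * (1 + x) ^ b * poly (jacobi_poly (real a) (real b) k) x * poly q x)
    has_integral 0) {-1..1}"
proof -
  define R :: "real poly" where "R = [:1, -1:] ^ (a + k) * [:1, 1:] ^ (b + k)"
  have R0: "poly ((pderiv ^^ i) R) x = 0" if "i < k" "x = 1 \<or> x = - 1" for i x
  proof -
    define D :: "real poly" where "D = [:1, -1:] * [:1, 1:]"
    have "D ^ (k - i) dvd (pderiv ^^ i) R" if "i \<le> k" for i
      using that
    proof (induction i)
      case 0
      show ?case
        unfolding D_def R_def power_mult_distrib by (auto intro!: mult_dvd_mono le_imp_power_dvd)
    next
      case (Suc i)
      define j where "j = k - Suc i"
      have "k - i = Suc j" using Suc.prems by (simp add: j_def)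
      with Suc obtain w where w: "(pderiv ^^ i) R = D ^ Suc j * w"
        by (auto elim: dvdE)
      have "(pderiv ^^ Suc i) R =
          D ^ j * (D * pderiv w + Polynomial.smult (of_nat (Suc j)) (pderiv D * w))"
        unfolding funpow.simps o_apply w pderiv_mult pderiv_power_Suc by (simp add: algebra_simps)
      thus ?case unfolding j_def by (metis dvd_triv_left)
    qed
    from this[of i] that obtain w where "(pderiv ^^ i) R = D ^ (k - i) * w" by (auto elim: dvdE)
    moreover have "poly D x = 0" using that by (auto simp: D_def)
    ultimately show ?thesis using that by simp
  qed
  have "((\<lambda>x. poly ((pderiv ^^ i) R) x * poly q x) has_integral 0) {-1..1}" if "i \<le> k" "degree q < i" for i q
    using that
  proof (induction i arbitrary: q)
    case (Suc i)
    have "((\<lambda>x. poly (pderiv ((pderiv ^^ i) R * q)) x) has_integral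
       (poly ((pderiv ^^ i) R * q) 1 - poly ((pderiv ^^ i) R * q) (-1))) {-1..1}"
      by (intro fundamental_theorem_of_calculus)
         (auto simp: has_real_derivative_iff_has_vector_derivative[symmetric]
            simp del: poly_mult intro: has_field_derivative_at_within[OF poly_DERIV])
    hence 1: "((\<lambda>x. poly ((pderiv ^^ i) R) x * poly (pderiv q) x + poly ((pderiv ^^ Suc i) R) x * poly q x) has_integral 0) {-1..1}"
      using R0[of i 1] R0[of i "-1"] Suc.prems by (simp add: pderiv_mult algebra_simps)
    have 2: "((\<lambda>x. poly ((pderiv ^^ i) R) x * poly (pderiv q) x) has_integral 0) {-1..1}"
    proof (cases "pderiv q = 0")
      case False
      hence "degree (pderiv q) < i" using Suc.prems
        by (auto simp: degree_pderiv pderiv_eq_0_iff)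
      thus ?thesis using Suc by auto
    qed auto
    show ?case using has_integral_diff[OF 1 2] by simp
  qed auto
  from this[of k q] assms
  have "((\<lambda>x. poly ((pderiv ^^ k) R) x * poly q x) has_integral 0) {-1..1}" by auto
  from has_integral_mult_right[OF this, of "1 / ((- 2) ^ k * fact k)"] show ?thesis
    unfolding R_def jacobi_poly_rodrigues by (simp add: mult.assoc)
qed

lemma degree_jacobi_poly: "degree (jacobi_poly (real a) (real b) k) = k"
proof (rule antisym)
  have d: "degree ([:- 1 / 2, 1 / 2 :: real:] ^ s * [:1 / 2, 1 / 2:] ^ (k - s)) = k" if "s \<le> k" for s
    using that by (simp add: degree_mult_eq degree_power_eq)
  show "degree (jacobi_poly (real a) (real b) k) \<le> k"
    unfolding jacobi_poly_def using d by (intro degree_sum_le) auto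
  have "Polynomial.coeff ([:- 1 / 2, 1 / 2 :: real:] ^ s * [:1 / 2, 1 / 2:] ^ (k - s)) k = (1 / 2) ^ k" if "s \<le> k" for s
  proof -
    have "lead_coeff ([:- 1 / 2, 1 / 2 :: real:] ^ s * [:1 / 2, 1 / 2:] ^ (k - s)) = (1 / 2) ^ k"
      using that by (simp add: lead_coeff_mult lead_coeff_power flip: power_add)
    thus ?thesis using d[OF that] by simp
  qed
  hence "Polynomial.coeff (jacobi_poly (real a) (real b) k) k =
     (\<Sum>s\<le>k. real ((k + a) choose (k - s)) * real ((k + b) choose s) * (1 / 2) ^ k)"
    by (simp add: jacobi_poly_def coeff_sum binomial_gbinomial)
  also have "\<dots> > 0" by (intro sum_pos) (auto simp: zero_less_binomial)
  finally show "k \<le> degree (jacobi_poly (real a) (real b) k)" by (intro le_degree) auto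
qed

lemma poly_jacobi_poly_1: "poly (jacobi_poly a b k) 1 = (real k + a) gchoose k"
proof -
  have "poly (jacobi_poly a b k) 1 = (\<Sum>s\<le>k. if s = 0 then (real k + a) gchoose k else 0)"
    unfolding jacobi_poly_def poly_sum by (intro sum.cong) auto
  thus ?thesis by simp
qed

text \<open>\<open>\<xi>\<close> enumerates the zeros in any order. Distinctness of the nodes and exactness on
  polynomials of degree below \<open>n\<close> already determine the weights.\<close>

definition gauss_jacobi11_rule :: "nat \<Rightarrow> (nat \<Rightarrow> real) \<Rightarrow> (nat \<Rightarrow> real) \<Rightarrow> bool" where
  "gauss_jacobi11_rule n \<xi> \<omega> \<longleftrightarrow>
     bij_betw \<xi> {..<n} {x. poly (jacobi_poly 1 1 n) x = 0} \<and>
     (\<forall>p :: real poly. degree p \<le> 2 * n - 1 \<longrightarrow>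
        ((\<lambda>x. (1 - x) * (1 + x) * poly p x) has_integral (\<Sum>i<n. \<omega> i * poly p (\<xi> i))) {-1..1})"

definition gauss_radau_rule :: "nat \<Rightarrow> (nat \<Rightarrow> real) \<Rightarrow> (nat \<Rightarrow> real) \<Rightarrow> bool" where
  "gauss_radau_rule m \<tau> \<rho> \<longleftrightarrow>
     \<tau> ` {..<m} = {x. poly (jacobi_poly 0 0 (m - 1) + jacobi_poly 0 0 m) x = 0} \<and>
     strict_mono_on {..<m} \<tau> \<and> \<tau> 0 = - 1 \<and> (\<forall>j<m. \<tau> j < 1) \<and>
     (\<forall>p :: real poly. degree p \<le> 2 * m - 2 \<longrightarrow>
        (poly p has_integral (\<Sum>j<m. \<rho> j * poly p (\<tau> j))) {-1..1})"

definition space_node :: "(nat \<Rightarrow> real) \<Rightarrow> nat \<Rightarrow> real" where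
  "space_node \<xi> i = (\<xi> i + 1) / 2"

definition time_node :: "nat \<Rightarrow> real \<Rightarrow> (nat \<Rightarrow> real) \<Rightarrow> nat \<Rightarrow> real" where
  "time_node m T \<tau> j = (if j < m then T / 2 * (\<tau> j + 1) else T)"

definition lagrange_basis :: "nat \<Rightarrow> (nat \<Rightarrow> real) \<Rightarrow> nat \<Rightarrow> real poly" where
  "lagrange_basis m t k = (\<Prod>i \<in> {..m} - {k}. Polynomial.smult (1 / (t k - t i)) [:- t i, 1:])"

definition time_diff_mat :: "nat \<Rightarrow> real \<Rightarrow> (nat \<Rightarrow> real) \<Rightarrow> real mat" where
  "time_diff_mat m T \<tau> = mat m (m + 1)
     (\<lambda>(j, k). poly (pderiv (lagrange_basis m (time_node m T \<tau>) k)) (time_node m T \<tau> j))"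

text \<open>Riemann--Liouville derivatives of order \<open>1 < \<alpha> < 2\<close> on \<open>[0, 1]\<close>.\<close>

definition rl_deriv_left :: "real \<Rightarrow> (real \<Rightarrow> real) \<Rightarrow> real \<Rightarrow> real" where
  "rl_deriv_left \<alpha> \<phi> x = 1 / Gamma (2 - \<alpha>) *
     (deriv ^^ 2) (\<lambda>y. integral {0..y} (\<lambda>s. (y - s) powr (1 - \<alpha>) * \<phi> s)) x"

definition rl_deriv_right :: "real \<Rightarrow> (real \<Rightarrow> real) \<Rightarrow> real \<Rightarrow> real" where
  "rl_deriv_right \<alpha> \<phi> x = 1 / Gamma (2 - \<alpha>) *
     (deriv ^^ 2) (\<lambda>y. integral {y..1} (\<lambda>s. (s - y) powr (1 - \<alpha>) * \<phi> s)) x"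

definition space_basis :: "nat \<Rightarrow> (nat \<Rightarrow> real) \<Rightarrow> nat \<Rightarrow> real \<Rightarrow> real" where
  "space_basis n \<xi> j x = x * (1 - x) / (space_node \<xi> j * (1 - space_node \<xi> j)) *
     (\<Prod>k \<in> {..<n} - {j}. (x - space_node \<xi> k) / (space_node \<xi> j - space_node \<xi> k))"

definition frac_diff_mat :: "nat \<Rightarrow> real \<Rightarrow> real \<Rightarrow> (nat \<Rightarrow> real) \<Rightarrow> real mat" where
  "frac_diff_mat n \<beta> r \<xi> = mat n n (\<lambda>(i, j).
     r * rl_deriv_left (2 - \<beta>) (space_basis n \<xi> j) (space_node \<xi> i) +
     (1 - r) * rl_deriv_right (2 - \<beta>) (space_basis n \<xi> j) (space_node \<xi> i))"

definition sample_mat ::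
  "nat \<Rightarrow> nat \<Rightarrow> real \<Rightarrow> (nat \<Rightarrow> real) \<Rightarrow> (nat \<Rightarrow> real) \<Rightarrow> (real \<Rightarrow> real \<Rightarrow> real) \<Rightarrow> real mat" where
  "sample_mat n m T \<xi> \<tau> q = mat n m (\<lambda>(i, j). q (space_node \<xi> i) (time_node m T \<tau> j))"

definition S_mat :: "nat \<Rightarrow> nat \<Rightarrow> real \<Rightarrow> (nat \<Rightarrow> real) \<Rightarrow> (nat \<Rightarrow> real) \<Rightarrow> real mat" where
  "S_mat n m T \<omega> \<rho> =
     diag_of_vec (kronecker_vec ((T / 2) \<cdot>\<^sub>v vec m \<rho>) ((1 / 2) \<cdot>\<^sub>v vec n \<omega>))"

definition Z_mat ::
  "nat \<Rightarrow> nat \<Rightarrow> real \<Rightarrow> (nat \<Rightarrow> real) \<Rightarrow> (nat \<Rightarrow> real) \<Rightarrow> (real \<Rightarrow> real \<Rightarrow> real) \<Rightarrow> real mat" where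
  "Z_mat n m T \<xi> \<tau> z = sample_mat n m T \<xi> \<tau> (\<lambda>x t. z x t / (x * (1 - x)))"

definition H_mat :: "nat \<Rightarrow> nat \<Rightarrow> real \<Rightarrow> (nat \<Rightarrow> real) \<Rightarrow> (nat \<Rightarrow> real) \<Rightarrow> real mat" where
  "H_mat n m T \<omega> \<rho> = four_block_mat
     (four_block_mat (S_mat n m T \<omega> \<rho>) (0\<^sub>m (n * m) n) (0\<^sub>m n (n * m)) (0\<^sub>m n n))
     (0\<^sub>m (n * m + n) (n * m))
     (0\<^sub>m (n * m) (n * m + n))
     (S_mat n m T \<omega> \<rho>)"

definition c_vec ::
  "nat \<Rightarrow> nat \<Rightarrow> real \<Rightarrow> (nat \<Rightarrow> real) \<Rightarrow> (nat \<Rightarrow> real) \<Rightarrow> (nat \<Rightarrow> real) \<Rightarrow> (nat \<Rightarrow> real) \<Rightarrow>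
    (real \<Rightarrow> real \<Rightarrow> real) \<Rightarrow> real vec" where
  "c_vec n m T \<xi> \<omega> \<tau> \<rho> z =
     - ((S_mat n m T \<omega> \<rho> *\<^sub>v vec_of_mat (Z_mat n m T \<xi> \<tau> z)) @\<^sub>v 0\<^sub>v n @\<^sub>v 0\<^sub>v (n * m))"

definition c0_const ::
  "nat \<Rightarrow> nat \<Rightarrow> real \<Rightarrow> (nat \<Rightarrow> real) \<Rightarrow> (nat \<Rightarrow> real) \<Rightarrow> (nat \<Rightarrow> real) \<Rightarrow> (nat \<Rightarrow> real) \<Rightarrow>
    (real \<Rightarrow> real \<Rightarrow> real) \<Rightarrow> real" where
  "c0_const n m T \<xi> \<omega> \<tau> \<rho> z =
     1 / 2 * (vec_of_mat (Z_mat n m T \<xi> \<tau> z) \<bullet>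
              (S_mat n m T \<omega> \<rho> *\<^sub>v vec_of_mat (Z_mat n m T \<xi> \<tau> z)))"

definition I_bar :: "nat \<Rightarrow> real mat" where \<comment> \<open>the identity of size \<open>m + 1\<close> without its last column\<close>
  "I_bar m = mat (m + 1) m (\<lambda>(i, j). 1\<^sub>m (m + 1) $$ (i, j))"

definition A_mat ::
  "nat \<Rightarrow> nat \<Rightarrow> real \<Rightarrow> real \<Rightarrow> real \<Rightarrow> (nat \<Rightarrow> real) \<Rightarrow> (nat \<Rightarrow> real) \<Rightarrow>
    (real \<Rightarrow> real \<Rightarrow> real) \<Rightarrow> real mat" where
  "A_mat n m T \<beta> r \<xi> \<tau> c = four_block_mat
     (append_cols (1\<^sub>m n) (0\<^sub>m n (n * m)))
     (0\<^sub>m n (n * m))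
     (kronecker (time_diff_mat m T \<tau>) (1\<^sub>m n) -
        diag_of_vec (vec_of_mat (sample_mat n m T \<xi> \<tau> c)) *
          kronecker (transpose_mat (I_bar m)) (frac_diff_mat n \<beta> r \<xi>))
     (- 1\<^sub>m (n * m))"

definition b_vec ::
  "nat \<Rightarrow> nat \<Rightarrow> real \<Rightarrow> (nat \<Rightarrow> real) \<Rightarrow> (nat \<Rightarrow> real) \<Rightarrow> (real \<Rightarrow> real \<Rightarrow> real) \<Rightarrow>
    (real \<Rightarrow> real) \<Rightarrow> real vec" where
  "b_vec n m T \<xi> \<tau> f g =
     vec n (\<lambda>i. g (space_node \<xi> i)) @\<^sub>v vec_of_mat (sample_mat n m T \<xi> \<tau> f)"

definition B_mat :: "nat \<Rightarrow> nat \<Rightarrow> real mat" where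
  "B_mat n m = - append_cols (0\<^sub>m (n * m) (n * (m + 1))) (1\<^sub>m (n * m))"

definition h_vec ::
  "nat \<Rightarrow> nat \<Rightarrow> real \<Rightarrow> (nat \<Rightarrow> real) \<Rightarrow> (nat \<Rightarrow> real) \<Rightarrow> (real \<Rightarrow> real \<Rightarrow> real) \<Rightarrow> real vec" where
  "h_vec n m T \<xi> \<tau> u_min = - vec_of_mat (sample_mat n m T \<xi> \<tau> u_min)"

lemma S_mat_carrier: "S_mat n m T \<omega> \<rho> \<in> carrier_mat (n * m) (n * m)"
  by (auto simp: S_mat_def diag_of_vec_def mat_diag_def kronecker_vec_def mult.commute)

lemma problem_data_carrier:
  "H_mat n m T \<omega> \<rho> \<in> carrier_mat (n * (2 * m + 1)) (n * (2 * m + 1))"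
  "c_vec n m T \<xi> \<omega> \<tau> \<rho> z \<in> carrier_vec (n * (2 * m + 1))"
  "A_mat n m T \<beta> r \<xi> \<tau> c \<in> carrier_mat (n * (m + 1)) (n * (2 * m + 1))"
  "b_vec n m T \<xi> \<tau> f g \<in> carrier_vec (n * (m + 1))"
  "B_mat n m \<in> carrier_mat (n * m) (n * (2 * m + 1))"
  "h_vec n m T \<xi> \<tau> u_min \<in> carrier_vec (n * m)"
  using carrier_matD[OF S_mat_carrier[of n m T \<omega> \<rho>]]
  by (auto intro!: carrier_vecI carrier_matI simp: H_mat_def c_vec_def A_mat_def b_vec_def B_mat_def h_vec_def append_cols_def
      vec_of_mat_def sample_mat_def kronecker_def I_bar_def frac_diff_mat_def time_diff_mat_def
      diag_of_vec_def mat_diag_def algebra_simps)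

end

theory Submission
  imports Defs
begin

text \<open>The constraints are affine, so the content lies in the objective: a quadratic
  function \<open>1 / 2 * (v \<bullet> (H *\<^sub>v v)) + c \<bullet> v + c0\<close> is convex as soon as the quadratic form of \<open>H\<close> is
  nonnegative (\<open>convex_problem_quadratic_problem\<close>). Here \<open>H\<close> is diagonal, and its diagonal consists of
  zeros and of products of a scaled Gauss-Radau weight and a scaled Gauss-Jacobi weight. So
  everything reduces to the nonnegativity of the quadrature weights.

  For this, a rule with \<open>n\<close> distinct nodes that is exact in degree \<open>2 * n - 2\<close> is applied to the square of the
  polynomial that vanishes at every node but one. The sum collapses to the weight at that node times
  a positive number, while the integral is that of a nonnegative function
  (\<open>quadrature_weight_nonneg\<close>). Both rules are exact up to that degree; for the Radau rule, which
  loses one degree of exactness to the prescribed endpoint, no degree is left to spare.\<close>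

section \<open>Nonnegativity of quadrature weights\<close>

text \<open>Squaring makes the test polynomial nonnegative between the nodes as well, at the cost of
  doubling its degree \<open>n - 1\<close>; this is where the exactness degree \<open>2 * n - 2\<close> comes from.\<close>

lemma quadrature_weight_nonneg:
  fixes x \<omega> :: "nat \<Rightarrow> real" and \<mu> :: "real \<Rightarrow> real"
  assumes exact: "\<And>p :: real poly. degree p \<le> 2 * n - 2 \<Longrightarrow>
      ((\<lambda>s. \<mu> s * poly p s) has_integral (\<Sum>i<n. \<omega> i * poly p (x i))) {a..b}"
    and \<mu>: "\<And>s. s \<in> {a..b} \<Longrightarrow> 0 \<le> \<mu> s"
    and inj: "inj_on x {..<n}" and j: "j < n"
  shows "0 \<le> \<omega> j"
proof -
  define q where "q = (\<Prod>k\<in>{..<n} - {j}. [:- x k, 1:])"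
  have "degree q = n - 1"
    unfolding q_def using j by (subst degree_prod_eq_sum_degree) auto
  then have "degree (q\<^sup>2) \<le> 2 * n - 2"
    using degree_power_le[of q 2] by simp
  from exact[OF this] have int:
    "((\<lambda>s. \<mu> s * poly (q\<^sup>2) s) has_integral (\<Sum>i<n. \<omega> i * poly (q\<^sup>2) (x i))) {a..b}" .
  have "poly q (x i) = 0" if "i < n" "i \<noteq> j" for i
    using that by (auto simp: q_def poly_prod)
  then have "(\<Sum>i<n. \<omega> i * poly (q\<^sup>2) (x i)) = (\<Sum>i<n. if i = j then \<omega> j * poly (q\<^sup>2) (x j) else 0)"
    by (intro sum.cong) (auto simp: poly_power)
  also have "\<dots> = \<omega> j * (poly q (x j))\<^sup>2"
    using j by (simp add: poly_power)
  finally have "0 \<le> \<omega> j * (poly q (x j))\<^sup>2"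
    using has_integral_nonneg[OF int] \<mu> by (simp add: poly_power)
  moreover have "poly q (x j) \<noteq> 0"
    using inj j by (auto simp: q_def poly_prod inj_on_def)
  ultimately show ?thesis
    by (simp add: zero_le_mult_iff)
qed

lemma gauss_jacobi11_weight_nonneg:
  assumes "gauss_jacobi11_rule n \<xi> \<omega>" "i < n"
  shows "0 \<le> \<omega> i"
proof (rule quadrature_weight_nonneg)
  show "((\<lambda>s. (1 - s) * (1 + s) * poly p s) has_integral (\<Sum>i<n. \<omega> i * poly p (\<xi> i))) {-1..1}"
    if "degree p \<le> 2 * n - 2" for p
    using assms(1) that unfolding gauss_jacobi11_rule_def by auto
  show "inj_on \<xi> {..<n}"
    using assms(1) by (auto simp: gauss_jacobi11_rule_def bij_betw_def)
qed (use assms(2) in auto)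

lemma gauss_radau_weight_nonneg:
  assumes "gauss_radau_rule m \<tau> \<rho>" "j < m"
  shows "0 \<le> \<rho> j"
proof (rule quadrature_weight_nonneg)
  show "((\<lambda>s. 1 * poly p s) has_integral (\<Sum>j<m. \<rho> j * poly p (\<tau> j))) {-1..1}"
    if "degree p \<le> 2 * m - 2" for p
    using assms(1) that unfolding gauss_radau_rule_def by auto
  show "inj_on \<tau> {..<m}"
    using assms(1) by (auto simp: gauss_radau_rule_def intro: strict_mono_on_imp_inj_on)
qed (use assms(2) in auto)

section \<open>Convex quadratic problems\<close>

lemma affine_fun_imp_convex_fun:
  assumes "affine_fun N \<phi>"
  shows "convex_fun N \<phi>"
proof -
  obtain a d where a: "a \<in> carrier_vec N" and \<phi>: "\<And>x. x \<in> carrier_vec N \<Longrightarrow> \<phi> x = a \<bullet> x + d"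
    using assms by (auto simp: affine_fun_def)
  have "\<phi> ((1 - t) \<cdot>\<^sub>v x + t \<cdot>\<^sub>v y) = (1 - t) * \<phi> x + t * \<phi> y"
    if "x \<in> carrier_vec N" "y \<in> carrier_vec N" for x y t
    using that a by (simp add: \<phi> scalar_prod_add_distrib[of _ N] algebra_simps)
  then show ?thesis by (simp add: convex_fun_def)
qed

lemma convex_fun_add:
  assumes "convex_fun N \<phi>" "convex_fun N \<psi>"
  shows "convex_fun N (\<lambda>v. \<phi> v + \<psi> v)"
  unfolding convex_fun_def
proof (intro ballI allI impI)
  fix x y :: "real vec" and t :: real
  assume "x \<in> carrier_vec N" "y \<in> carrier_vec N" "0 \<le> t \<and> t \<le> 1"
  then have "\<phi> ((1 - t) \<cdot>\<^sub>v x + t \<cdot>\<^sub>v y) \<le> (1 - t) * \<phi> x + t * \<phi> y"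
    "\<psi> ((1 - t) \<cdot>\<^sub>v x + t \<cdot>\<^sub>v y) \<le> (1 - t) * \<psi> x + t * \<psi> y"
    using assms by (auto simp: convex_fun_def)
  then show "\<phi> ((1 - t) \<cdot>\<^sub>v x + t \<cdot>\<^sub>v y) + \<psi> ((1 - t) \<cdot>\<^sub>v x + t \<cdot>\<^sub>v y)
      \<le> (1 - t) * (\<phi> x + \<psi> x) + t * (\<phi> y + \<psi> y)"
    unfolding distrib_left by linarith
qed

lemma convex_fun_cmult:
  assumes "convex_fun N \<phi>" "0 \<le> a"
  shows "convex_fun N (\<lambda>v. a * \<phi> v)"
  unfolding convex_fun_def
proof (intro ballI allI impI)
  fix x y :: "real vec" and t :: real
  assume "x \<in> carrier_vec N" "y \<in> carrier_vec N" "0 \<le> t \<and> t \<le> 1"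
  then have "\<phi> ((1 - t) \<cdot>\<^sub>v x + t \<cdot>\<^sub>v y) \<le> (1 - t) * \<phi> x + t * \<phi> y"
    using assms by (auto simp: convex_fun_def)
  from mult_left_mono[OF this assms(2)]
  show "a * \<phi> ((1 - t) \<cdot>\<^sub>v x + t \<cdot>\<^sub>v y) \<le> (1 - t) * (a * \<phi> x) + t * (a * \<phi> y)"
    by (simp only: distrib_left mult.left_commute)
qed

lemma affine_fun_linear_constraint:
  assumes "A \<in> carrier_mat k N" "i < k"
  shows "affine_fun N (\<lambda>v. (A *\<^sub>v v) $ i - b $ i)"
  unfolding affine_fun_def using assms
  by (intro bexI[of _ "row A i"] exI[of _ "- b $ i"]) auto

text \<open>The defect in the convexity inequality is \<open>t * (1 - t)\<close> times the form at \<open>x - y\<close>,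
  an identity of polynomials in the coordinates.\<close>

lemma convex_fun_quadratic_form:
  assumes H: "H \<in> carrier_mat N N"
    and nonneg: "\<And>v. v \<in> carrier_vec N \<Longrightarrow> 0 \<le> v \<bullet> (H *\<^sub>v v)"
  shows "convex_fun N (\<lambda>v. v \<bullet> (H *\<^sub>v v))"
  unfolding convex_fun_def
proof (intro ballI allI impI)
  fix x y :: "real vec" and t :: real
  assume x: "x \<in> carrier_vec N" and y: "y \<in> carrier_vec N" and t: "0 \<le> t \<and> t \<le> 1"
  let ?q = "\<lambda>v. v \<bullet> (H *\<^sub>v v)"
  have q: "?q v = (\<Sum>i<N. \<Sum>j<N. H $$ (i, j) * (v $ i * v $ j))" if "v \<in> carrier_vec N" for v
    using H that by (auto simp: scalar_prod_def sum_distrib_left lessThan_atLeast0 mult_ac intro!: sum.cong)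
  have comb: "(1 - t) \<cdot>\<^sub>v x + t \<cdot>\<^sub>v y \<in> carrier_vec N" and diff: "x - y \<in> carrier_vec N"
    using x y by auto
  have "(1 - t) * ?q x + t * ?q y - ?q ((1 - t) \<cdot>\<^sub>v x + t \<cdot>\<^sub>v y) = t * (1 - t) * ?q (x - y)"
    unfolding q[OF x] q[OF y] q[OF diff] q[OF comb] sum_distrib_left sum.distrib[symmetric] sum_subtractf[symmetric]
    using x y by (intro sum.cong refl) (simp add: algebra_simps)
  also have "\<dots> \<ge> 0"
    using t nonneg[OF diff] by simp
  finally show "?q ((1 - t) \<cdot>\<^sub>v x + t \<cdot>\<^sub>v y) \<le> (1 - t) * ?q x + t * ?q y"
    by simp
qed

lemma convex_problem_quadratic_problem:
  assumes H: "H \<in> carrier_mat N N"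
    and nonneg: "\<And>v. v \<in> carrier_vec N \<Longrightarrow> 0 \<le> v \<bullet> (H *\<^sub>v v)"
    and c: "c \<in> carrier_vec N" and A: "A \<in> carrier_mat k N" and B: "B \<in> carrier_mat l N"
  shows "convex_problem (quadratic_problem N H c c0 A b B h)"
proof -
  have lin: "convex_fun N (\<lambda>v. c \<bullet> v + c0)"
    using c by (intro affine_fun_imp_convex_fun) (auto simp: affine_fun_def)
  have "convex_fun N (\<lambda>v. 1 / 2 * (v \<bullet> (H *\<^sub>v v)) + (c \<bullet> v + c0))"
    by (intro convex_fun_add[OF _ lin] convex_fun_cmult convex_fun_quadratic_form H nonneg) auto
  then have "convex_fun N (\<lambda>v. 1 / 2 * (v \<bullet> (H *\<^sub>v v)) + c \<bullet> v + c0)"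
    by (simp add: add.assoc)
  then show ?thesis
    using affine_fun_linear_constraint[OF A] affine_fun_linear_constraint[OF B] A B
    by (auto simp: convex_problem_def quadratic_problem_def intro!: affine_fun_imp_convex_fun)
qed

section \<open>The Hessian of the discretized problem\<close>

lemma diagonal_quadratic_form_nonneg:
  fixes D :: "real mat"
  assumes D: "D \<in> carrier_mat N N" "diagonal_mat D" and nonneg: "\<And>i. i < N \<Longrightarrow> 0 \<le> D $$ (i, i)"
    and v: "v \<in> carrier_vec N"
  shows "0 \<le> v \<bullet> (D *\<^sub>v v)"
proof -
  have "(D *\<^sub>v v) $ i = D $$ (i, i) * v $ i" if i: "i < N" for i
  proof -
    have "(D *\<^sub>v v) $ i = (\<Sum>j<N. D $$ (i, j) * v $ j)"
      using D v i by (auto simp: scalar_prod_def lessThan_atLeast0)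
    also have "\<dots> = (\<Sum>j<N. if j = i then D $$ (i, i) * v $ i else 0)"
      using D i by (intro sum.cong) (auto simp: diagonal_mat_def)
    finally show ?thesis using i by simp
  qed
  then have "v \<bullet> (D *\<^sub>v v) = (\<Sum>i<N. D $$ (i, i) * (v $ i)\<^sup>2)"
    using D v by (auto simp: scalar_prod_def lessThan_atLeast0 power2_eq_square intro!: sum.cong)
  then show ?thesis
    using nonneg by (auto intro!: sum_nonneg)
qed

text \<open>The Kronecker index \<open>i\<close> splits into the time index \<open>i div n\<close> and the space index \<open>i mod n\<close>, so
  every diagonal entry pairs a weight of each rule.\<close>

lemma S_mat_index:
  assumes "i < n * m" "j < n * m"
  shows "S_mat n m T \<omega> \<rho> $$ (i, j) =
    (if i = j then T / 2 * \<rho> (i div n) * (1 / 2 * \<omega> (i mod n)) else 0)"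
proof -
  from assms have "0 < n" by (cases n) auto
  then have "j div n < m" "j mod n < n"
    using assms(2) by (auto simp: less_mult_imp_div_less mult.commute)
  then show ?thesis
    using assms by (auto simp: S_mat_def diag_of_vec_def mat_diag_def kronecker_vec_def mult.commute)
qed

lemma H_mat_quadratic_form_nonneg:
  assumes "T > 0" "gauss_jacobi11_rule n \<xi> \<omega>" "gauss_radau_rule m \<tau> \<rho>"
    and v: "v \<in> carrier_vec (n * (2 * m + 1))"
  shows "0 \<le> v \<bullet> (H_mat n m T \<omega> \<rho> *\<^sub>v v)"
proof (rule diagonal_quadratic_form_nonneg[OF problem_data_carrier(1) _ _ v])
  note S = carrier_matD[OF S_mat_carrier[of n m T \<omega> \<rho>]]
  have S_nonneg: "0 \<le> S_mat n m T \<omega> \<rho> $$ (i, i)" if i: "i < n * m" for i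
  proof -
    from i have "0 < n" by (cases n) auto
    then have "0 \<le> \<rho> (i div n)" "0 \<le> \<omega> (i mod n)"
      using i gauss_radau_weight_nonneg[OF assms(3)] gauss_jacobi11_weight_nonneg[OF assms(2)]
      by (auto simp: less_mult_imp_div_less mult.commute)
    then show ?thesis using i assms(1) by (simp add: S_mat_index)
  qed
  show "diagonal_mat (H_mat n m T \<omega> \<rho>)"
    unfolding diagonal_mat_def by (auto simp: H_mat_def S S_mat_index)
  show "0 \<le> H_mat n m T \<omega> \<rho> $$ (i, i)" if "i < n * (2 * m + 1)" for i
    using that by (auto simp: H_mat_def S S_nonneg algebra_simps)
qed

theorem theorem6:
  fixes n m :: nat and T \<beta> r :: real
    and c f z u_min :: "real \<Rightarrow> real \<Rightarrow> real" and g :: "real \<Rightarrow> real"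
    and \<xi> \<omega> \<tau> \<rho> :: "nat \<Rightarrow> real"
  assumes "n \<ge> 1" and "m \<ge> 1" and "T > 0" and "0 < \<beta>" and "\<beta> < 1"
    and "gauss_jacobi11_rule n \<xi> \<omega>"
    and "gauss_radau_rule m \<tau> \<rho>"
  shows "convex_problem (quadratic_problem (n * (2 * m + 1))
    (H_mat n m T \<omega> \<rho>) (c_vec n m T \<xi> \<omega> \<tau> \<rho> z) (c0_const n m T \<xi> \<omega> \<tau> \<rho> z)
    (A_mat n m T \<beta> r \<xi> \<tau> c) (b_vec n m T \<xi> \<tau> f g)
    (B_mat n m) (h_vec n m T \<xi> \<tau> u_min))"
  by (rule convex_problem_quadratic_problem[OF problem_data_carrier(1) _ problem_data_carrier(2,3,5)])
    (rule H_mat_quadratic_form_nonneg[OF assms(3,6,7)])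

end
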